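(* Let $G$ be a countable left-orderable group, and let $$\mathrm{LO}((G))=\{P\in\mathrm{LO}(G) : g^{-1}Pg\neq P \text{ for all } g\in G\setminus\{id\}\}$$ be the free part of the conjugation action of $G$ on $\mathrm{LO}(G)$. If $\mathrm{LO}((G))\neq\emptyset$, then $E_{\mathsf{lo}}(G)$ is not smooth.
   Context: A positive cone of a group $G$ is a subset $P\subseteq G$ with $P\cdot P\subseteq P$ and $P\sqcup P^{-1}=G\setminus\{id\}$ (disjoint union). Positive cones correspond to left-orderings (strict total orders $<$ with $g<h\Rightarrow fg<fh$) via $P=\{g: g>id\}$; $G$ is left-orderable if it admits a left-ordering, equivalently if it has a positive cone. For a countable group $G$, $\mathrm{LO}(G)\subseteq\{0,1\}^G$ is the set of all positive cones with the subspace topology of the product topology ($\{0,1\}$ discrete); it is a compact Polish space when $G$ is left-orderable. $G$ acts on $\mathrm{LO}(G)$ by homeomorphisms via $g\cdot P=gPg^{-1}$, and $E_{\mathsf{lo}}(G)$ is the orbit equivalence relation of this action. A Borel equivalence relation $E$ on a Polish space $X$ is smooth if there are a standard Borel space $Y$ and a Borel map $\theta\colon X\to Y$ such that $x_1\mathbin{E}x_2\iff\theta(x_1)=\theta(x_2)$.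
   Formalization: The group G is assumed to be nontrivial; for the trivial group LO(G) = LO((G)) = {∅} is a single point, so the free part is nonempty while E_lo(G) is smooth, and the claim fails. *)

theory Defs
  imports "HOL-Analysis.Analysis" "HOL-Algebra.Group_Action"
begin

section \<open>Left-orderings and positive cones\<close>

definition left_ordering :: "('a, 'b) monoid_scheme \<Rightarrow> 'a rel \<Rightarrow> bool" where
  "left_ordering G r \<longleftrightarrow>
     r \<subseteq> carrier G \<times> carrier G \<and> strict_linear_order_on (carrier G) r \<and>
     (\<forall>f \<in> carrier G. \<forall>(g, h) \<in> r. (f \<otimes>\<^bsub>G\<^esub> g, f \<otimes>\<^bsub>G\<^esub> h) \<in> r)"

definition left_orderable :: "('a, 'b) monoid_scheme \<Rightarrow> bool" where
  "left_orderable G \<longleftrightarrow> (\<exists>r. left_ordering G r)"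

definition positive_cone :: "('a, 'b) monoid_scheme \<Rightarrow> 'a set \<Rightarrow> bool" where
  "positive_cone G P \<longleftrightarrow>
     P \<subseteq> carrier G \<and> P <#>\<^bsub>G\<^esub> P \<subseteq> P \<and>
     P \<inter> set_inv\<^bsub>G\<^esub> P = {} \<and> P \<union> set_inv\<^bsub>G\<^esub> P = carrier G - {\<one>\<^bsub>G\<^esub>}"

definition LO :: "('a, 'b) monoid_scheme \<Rightarrow> 'a set set" where
  "LO G = {P. positive_cone G P}"

text \<open>Positive cones are kept as sets; the topology is the one induced from the product
  \<open>{0,1}\<^sup>G\<close> (with \<^typ>\<open>bool\<close> for \<open>{0,1}\<close>) by sending a cone to its
  characteristic function on the carrier.\<close>

definition LO_topology :: "('a, 'b) monoid_scheme \<Rightarrow> 'a set topology" where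
  "LO_topology G =
     pullback_topology (LO G) (\<lambda>P. \<lambda>g \<in> carrier G. g \<in> P)
       (product_topology (\<lambda>_. discrete_topology (UNIV :: bool set)) (carrier G))"

lemma topspace_LO_topology: "topspace (LO_topology G) = LO G"
  by (auto simp: LO_topology_def topspace_pullback_topology)

definition conjugate :: "('a, 'b) monoid_scheme \<Rightarrow> 'a \<Rightarrow> 'a set \<Rightarrow> 'a set" where
  "conjugate G g P = g <#\<^bsub>G\<^esub> P #>\<^bsub>G\<^esub> inv\<^bsub>G\<^esub> g"

definition E_lo :: "('a, 'b) monoid_scheme \<Rightarrow> 'a set rel" where
  "E_lo G = {(P, Q). P \<in> LO G \<and> Q \<in> orbit G (conjugate G) P}"

definition LO_free :: "('a, 'b) monoid_scheme \<Rightarrow> 'a set set" where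
  "LO_free G =
     {P \<in> LO G. \<forall>g \<in> carrier G - {\<one>\<^bsub>G\<^esub>}. inv\<^bsub>G\<^esub> g <#\<^bsub>G\<^esub> P #>\<^bsub>G\<^esub> g \<noteq> P}"

section \<open>Smooth equivalence relations\<close>

definition polish_space :: "'x topology \<Rightarrow> bool" where
  "polish_space X \<longleftrightarrow>
     completely_metrizable_space X \<and>
     (\<exists>D \<subseteq> topspace X. countable D \<and> X closure_of D = topspace X)"

definition borel_of :: "'x topology \<Rightarrow> 'x measure" where
  "borel_of X = sigma (topspace X) {U. openin X U}"

definition standard_borel :: "'y measure \<Rightarrow> bool" where
  "standard_borel Y \<longleftrightarrow> (\<exists>S. polish_space S \<and> sets Y = sets (borel_of S))"

text \<open>The definition is meant for a Borel equivalence relation \<open>E\<close> on a Polish space \<open>X\<close>.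
  HOL cannot quantify over the type of points of the standard Borel space \<open>Y\<close> inside a formula,
  so that type is a parameter. Nonsmoothness of \<open>E\<close> is \<open>\<not> smooth TYPE('y) X E\<close> with
  \<open>'y\<close> a free type variable of the theorem, hence for \<open>Y\<close> over every type.\<close>

definition smooth :: "'y itself \<Rightarrow> 'x topology \<Rightarrow> 'x rel \<Rightarrow> bool" where
  "smooth (_ :: 'y itself) X E \<longleftrightarrow>
     (\<exists>(Y :: 'y measure) \<theta>. standard_borel Y \<and> \<theta> \<in> borel_of X \<rightarrow>\<^sub>M Y \<and>
        (\<forall>x1 \<in> topspace X. \<forall>x2 \<in> topspace X. (x1, x2) \<in> E \<longleftrightarrow> \<theta> x1 = \<theta> x2))"

end

theory Submission
  imports Defs
begin

text \<open>A cone \<open>P\<close> in the free part is a limit of other cones in its own orbit. A neighbourhood of \<open>P\<close>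
  only prescribes that finitely many elements \<open>g\<^sub>1, \<dots>, g\<^sub>n\<close> of \<open>P\<close> stay positive. Let \<open>h\<close> be the least of
  them for the left-ordering of \<open>P\<close>. Then \<open>g\<^sub>i h > g\<^sub>i \<ge> h\<close>, since left multiplication preserves the order,
  so that \<open>h\<^sup>-\<^sup>1 g\<^sub>i h\<close> is positive for all \<open>i\<close>. Hence \<open>h P h\<^sup>-\<^sup>1\<close> lies in the neighbourhood, and it differs
  from \<open>P\<close> because \<open>P\<close> has trivial stabiliser
  (\<open>positive_cone_finitely_many_conjugates\<close>, \<open>free_cone_accumulates_on_itself\<close>).

  The rest is a Baire category argument on the closure \<open>K\<close> of the orbit of \<open>P\<close>. This is a compact Hausdorff
  space on which \<open>G\<close> acts by homeomorphisms with a dense orbit. It has no isolated points: such a point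
  would lie in the dense orbit, and conjugating it back would isolate \<open>P\<close> in its orbit. By the
  topological zero-one law every invariant Borel subset of \<open>K\<close> is meager or comeager. If \<open>\<theta>\<close> were a
  Borel reduction to equality on a standard Borel space, the preimages of a countable separating family
  would be such sets, so \<open>\<theta>\<close> would be constant on a comeager set. That set would lie in a single orbit;
  but orbits are countable, hence meager in \<open>K\<close>.\<close>

section \<open>Meager sets\<close>

definition meager_in :: "'x topology \<Rightarrow> 'x set \<Rightarrow> bool" where
  "meager_in T A \<longleftrightarrow>
     (\<exists>\<C>. countable \<C> \<and> (\<forall>C\<in>\<C>. closedin T C \<and> T interior_of C = {}) \<and> A \<subseteq> \<Union>\<C>)"

lemma meager_in_nowhere_dense:
  "closedin T C \<Longrightarrow> T interior_of C = {} \<Longrightarrow> meager_in T C"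
  unfolding meager_in_def by (rule exI[of _ "{C}"]) auto

lemma meager_in_subset: "meager_in T B \<Longrightarrow> A \<subseteq> B \<Longrightarrow> meager_in T A"
  unfolding meager_in_def by (meson order_trans)

lemma meager_in_UN:
  assumes "countable I" "\<And>i. i \<in> I \<Longrightarrow> meager_in T (A i)"
  shows "meager_in T (\<Union>i\<in>I. A i)"
proof -
  have "\<forall>i\<in>I. \<exists>\<C>. countable \<C> \<and> (\<forall>C\<in>\<C>. closedin T C \<and> T interior_of C = {}) \<and> A i \<subseteq> \<Union>\<C>"
    using assms(2) unfolding meager_in_def by blast
  then obtain \<C> where \<C>: "\<forall>i\<in>I. countable (\<C> i) \<and>
      (\<forall>C\<in>\<C> i. closedin T C \<and> T interior_of C = {}) \<and> A i \<subseteq> \<Union>(\<C> i)"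
    by metis
  show ?thesis
    unfolding meager_in_def
  proof (intro exI[of _ "\<Union>i\<in>I. \<C> i"] conjI)
    show "countable (\<Union>i\<in>I. \<C> i)" using assms(1) \<C> by auto
    show "\<forall>C\<in>\<Union>i\<in>I. \<C> i. closedin T C \<and> T interior_of C = {}" using \<C> by auto
    show "(\<Union>i\<in>I. A i) \<subseteq> \<Union>(\<Union>i\<in>I. \<C> i)"
    proof
      fix x assume "x \<in> (\<Union>i\<in>I. A i)"
      then obtain i where "i \<in> I" "x \<in> A i" by blast
      then have "x \<in> \<Union>(\<C> i)" using \<C> by blast
      then show "x \<in> \<Union>(\<Union>i\<in>I. \<C> i)" using \<open>i \<in> I\<close> by blast
    qed
  qed
qed

lemma meager_in_Un: "meager_in T A \<Longrightarrow> meager_in T B \<Longrightarrow> meager_in T (A \<union> B)"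
  using meager_in_UN[of "UNIV :: bool set" T "\<lambda>b. if b then A else B"] by (simp add: UNIV_bool Un_commute)

lemma meager_in_countable:
  assumes "t1_space T" "\<And>x. x \<in> topspace T \<Longrightarrow> \<not> openin T {x}" "countable A" "A \<subseteq> topspace T"
  shows "meager_in T A"
proof -
  have "meager_in T {x}" if "x \<in> topspace T" for x
  proof (rule meager_in_nowhere_dense)
    show "closedin T {x}" using assms(1) that t1_space_closedin_singleton[of T] by simp
    have "T interior_of {x} = {} \<or> T interior_of {x} = {x}"
      using interior_of_subset[of T "{x}"] by (simp add: subset_singleton_iff)
    then show "T interior_of {x} = {}"
      using assms(2)[OF that] openin_interior_of[of T "{x}"] by force
  qed
  then have "meager_in T (\<Union>x\<in>A. {x})"
    using assms(3,4) by (intro meager_in_UN) (blast+)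
  then show ?thesis by simp
qed

lemma meager_in_homeomorphic_image:
  assumes f: "homeomorphic_map T T f" and "meager_in T A"
  shows "meager_in T (f ` A)"
proof -
  obtain \<C> where \<C>: "countable \<C>" "\<forall>C\<in>\<C>. closedin T C \<and> T interior_of C = {}" "A \<subseteq> \<Union>\<C>"
    using assms(2) unfolding meager_in_def by blast
  show ?thesis
    unfolding meager_in_def
  proof (intro exI[of _ "image f ` \<C>"] conjI ballI)
    fix D assume "D \<in> image f ` \<C>"
    then obtain C where C: "C \<in> \<C>" "D = f ` C" by blast
    then have "C \<subseteq> topspace T" using \<C>(2) closedin_subset by blast
    then show "closedin T D" "T interior_of D = {}"
      using C \<C>(2) homeomorphic_map_closedness[OF f] homeomorphic_map_interior_of[OF f] by auto
  next
    show "f ` A \<subseteq> \<Union>(image f ` \<C>)" using \<C>(3) by blast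
  qed (use \<C>(1) in simp)
qed

lemma locally_compact_regular_not_meager:
  assumes "locally_compact_space T" "regular_space T" "topspace T \<noteq> {}"
  shows "\<not> meager_in T (topspace T)"
proof
  assume "meager_in T (topspace T)"
  then obtain \<C> where \<C>: "countable \<C>" "\<And>C. C \<in> \<C> \<Longrightarrow> closedin T C \<and> T interior_of C = {}"
      "topspace T \<subseteq> \<Union>\<C>"
    unfolding meager_in_def by blast
  have "\<Union>\<C> = topspace T"
    using \<C> closedin_subset by blast
  moreover have "T interior_of \<Union>\<C> = {}"
    using assms \<C> by (intro Baire_category_alt) auto
  ultimately show False using assms(3) by simp
qed

section \<open>Borel sets and generic ergodicity\<close>

text \<open>Sets that agree with an open set up to a meager set form a \<open>\<sigma>\<close>-algebra. Only complements need thought: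
  the complement of an open set is closed, and a closed set differs from its interior by a closed set
  with empty interior.\<close>

lemma borel_eq_open_mod_meager:
  assumes "A \<in> sets (borel_of T)"
  shows "\<exists>U. openin T U \<and> meager_in T ((A - U) \<union> (U - A))"
proof -
  have sub: "{U. openin T U} \<subseteq> Pow (topspace T)"
    using openin_subset by auto
  have "A \<in> sigma_sets (topspace T) {U. openin T U}"
    using assms sub by (simp add: borel_of_def)
  then show ?thesis
  proof induction
    case (Basic A)
    then show ?case
      by (intro exI[of _ A]) (auto simp: meager_in_def)
  next
    case Empty
    then show ?case
      by (intro exI[of _ "{}"]) (auto simp: meager_in_def)
  next
    case (Compl A)
    then obtain U where U: "openin T U" "meager_in T ((A - U) \<union> (U - A))" by blast
    define C where "C = topspace T - U"
    define V where "V = T interior_of C"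
    have C: "closedin T C" unfolding C_def using U(1) by blast
    have V: "openin T V" "V \<subseteq> C" by (simp_all add: V_def interior_of_subset)
    \<comment> \<open>\<open>C - V\<close> is the boundary part by which \<open>C\<close> exceeds the open set \<open>V\<close>.\<close>
    have "T interior_of (C - V) \<subseteq> V \<inter> (C - V)"
      unfolding V_def using interior_of_mono[of "C - V" C T] interior_of_subset[of T "C - V"]
      by (auto simp: V_def)
    then have "meager_in T (C - V)"
      using C V by (intro meager_in_nowhere_dense) (auto simp: closedin_diff)
    from meager_in_Un[OF U(2) this] have "meager_in T (((A - U) \<union> (U - A)) \<union> (C - V))"
 .
    then have "meager_in T ((topspace T - A - V) \<union> (V - (topspace T - A)))"
      by (rule meager_in_subset) (use V C_def in auto)
    then show ?case using V by blast
  next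
    case (Union A)
    then obtain U where U: "\<And>i::nat. openin T (U i)" "\<And>i. meager_in T ((A i - U i) \<union> (U i - A i))"
      by metis
    have "meager_in T (\<Union>i\<in>UNIV. ((A i - U i) \<union> (U i - A i)))"
      by (rule meager_in_UN) (use U in auto)
    then have "meager_in T (((\<Union>i. A i) - (\<Union>i. U i)) \<union> ((\<Union>i. U i) - (\<Union>i. A i)))"
      by (rule meager_in_subset) auto
    moreover have "openin T (\<Union>i. U i)" using U by auto
    ultimately show ?case by blast
  qed
qed

text \<open>A nonmeager invariant Borel set fills some nonempty open set up to a meager set. By invariance it
  also fills, up to countably many meager sets, all translates of that open set; by transitivity their
  union is dense.\<close>

lemma topological_zero_one_law:
  assumes F: "countable F" "\<And>f. f \<in> F \<Longrightarrow> homeomorphic_map T T f"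
    and trans: "\<And>U W. openin T U \<Longrightarrow> openin T W \<Longrightarrow> U \<noteq> {} \<Longrightarrow> W \<noteq> {} \<Longrightarrow> \<exists>f\<in>F. f ` U \<inter> W \<noteq> {}"
    and A: "A \<in> sets (borel_of T)"
    and inv: "\<And>f x. f \<in> F \<Longrightarrow> x \<in> topspace T \<Longrightarrow> f x \<in> A \<longleftrightarrow> x \<in> A"
  shows "meager_in T A \<or> meager_in T (topspace T - A)"
proof -
  obtain U where U: "openin T U" "meager_in T ((A - U) \<union> (U - A))"
    using borel_eq_open_mod_meager[OF A] by blast
  show ?thesis
  proof (cases "U = {}")
    case True
    then show ?thesis using U by simp
  next
    case False
    define V where "V = (\<Union>f\<in>F. f ` U)"
    have UT: "U \<subseteq> topspace T" using U openin_subset by blast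
    have opV: "openin T V"
      unfolding V_def using U F homeomorphic_map_openness_eq by blast
    have "T interior_of (topspace T - V) = {}"
    proof (rule ccontr)
      assume "T interior_of (topspace T - V) \<noteq> {}"
      from trans[OF U(1) openin_interior_of False this]
      obtain f where "f \<in> F" "f ` U \<inter> T interior_of (topspace T - V) \<noteq> {}" by blast
      then show False
        using interior_of_subset[of T "topspace T - V"] by (auto simp: V_def)
    qed
    then have 1: "meager_in T (topspace T - V)"
      using opV by (intro meager_in_nowhere_dense) auto
    have "meager_in T (\<Union>f\<in>F. f ` (U - A))"
      using F U(2) by (intro meager_in_UN meager_in_homeomorphic_image) (auto intro: meager_in_subset)
    then have "meager_in T (V - A)"
    proof (rule meager_in_subset, intro subsetI)
      fix y assume "y \<in> V - A"
      then obtain f u where fu: "f \<in> F" "u \<in> U" "y = f u" "f u \<notin> A" by (auto simp: V_def)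
      then have "u \<in> U - A" using inv UT by blast
      then show "y \<in> (\<Union>f\<in>F. f ` (U - A))" using fu by blast
    qed
    then have "meager_in T ((topspace T - V) \<union> (V - A))"
      using 1 by (intro meager_in_Un)
    then show ?thesis
      by (intro disjI2, rule meager_in_subset) auto
  qed
qed

text \<open>The members of a countable invariant family that are comeager, together with the complements of the
  others, meet in a comeager set, no two points of which the family can distinguish. In a Baire space
  without isolated points a comeager set is uncountable. Hence no countable invariant Borel family
  can separate the orbits of a countable group here.\<close>

lemma uncountable_class_of_invariant_borel_family:
  assumes T: "locally_compact_space T" "Hausdorff_space T" "topspace T \<noteq> {}"
    and perfect: "\<And>x. x \<in> topspace T \<Longrightarrow> \<not> openin T {x}"
    and F: "countable F" "\<And>f. f \<in> F \<Longrightarrow> homeomorphic_map T T f"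
    and trans: "\<And>U W. openin T U \<Longrightarrow> openin T W \<Longrightarrow> U \<noteq> {} \<Longrightarrow> W \<noteq> {} \<Longrightarrow> \<exists>f\<in>F. f ` U \<inter> W \<noteq> {}"
    and \<B>: "countable \<B>" "\<B> \<subseteq> sets (borel_of T)"
    and inv: "\<And>B f x. B \<in> \<B> \<Longrightarrow> f \<in> F \<Longrightarrow> x \<in> topspace T \<Longrightarrow> f x \<in> B \<longleftrightarrow> x \<in> B"
  shows "\<exists>x\<in>topspace T. uncountable {y \<in> topspace T. \<forall>B\<in>\<B>. y \<in> B \<longleftrightarrow> x \<in> B}"
proof -
  \<comment> \<open>By the zero-one law, membership in \<open>B\<close> has a generic value, namely that \<open>B\<close> is not meager.\<close>
  define M where "M = {x \<in> topspace T. \<forall>B\<in>\<B>. x \<in> B \<longleftrightarrow> \<not> meager_in T B}"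
  have "meager_in T {x \<in> topspace T. (x \<in> B) = meager_in T B}" if "B \<in> \<B>" for B
  proof (cases "meager_in T B")
    case True
    then show ?thesis by (rule meager_in_subset) (use True in auto)
  next
    case False
    have "meager_in T B \<or> meager_in T (topspace T - B)"
      by (rule topological_zero_one_law[OF F trans]) (use \<B>(2) inv that in auto)
    with False have "meager_in T (topspace T - B)" by simp
    then show ?thesis by (rule meager_in_subset) (use False in auto)
  qed
  then have "meager_in T (\<Union>B\<in>\<B>. {x \<in> topspace T. (x \<in> B) = meager_in T B})"
    using \<B> by (intro meager_in_UN)
  then have 1: "meager_in T (topspace T - M)"
    by (rule meager_in_subset) (auto simp: M_def)
  have nonmeager: "\<not> meager_in T (topspace T)"
    using T locally_compact_Hausdorff_imp_regular_space locally_compact_regular_not_meager by blast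
  have "topspace T \<subseteq> (topspace T - M) \<union> M" by blast
  then have M: "\<not> meager_in T M"
    using meager_in_Un[OF 1] meager_in_subset nonmeager by blast
  then have "uncountable M"
    using meager_in_countable[OF Hausdorff_imp_t1_space[OF T(2)] perfect] by (auto simp: M_def)
  moreover from this obtain x where x: "x \<in> M" by fastforce
  moreover have "M \<subseteq> {y \<in> topspace T. \<forall>B\<in>\<B>. y \<in> B \<longleftrightarrow> x \<in> B}"
    using x by (auto simp: M_def)
  ultimately show ?thesis
    using countable_subset by (intro bexI[of _ x]) (auto simp: M_def)
qed

section \<open>Standard Borel spaces\<close>

text \<open>Balls of radius \<open>1/(n+1)\<close> around a countable dense set separate points of a metric space.\<close>

lemma standard_borel_countably_separated:
  assumes "standard_borel Y"
  obtains \<B> where "countable \<B>" "\<B> \<subseteq> sets Y"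
    "\<And>x y. x \<in> space Y \<Longrightarrow> y \<in> space Y \<Longrightarrow> (\<And>B. B \<in> \<B> \<Longrightarrow> x \<in> B \<longleftrightarrow> y \<in> B) \<Longrightarrow> x = y"
proof -
  obtain S D where S: "completely_metrizable_space S" "sets Y = sets (borel_of S)"
    and D: "countable D" "D \<subseteq> topspace S" "S closure_of D = topspace S"
    using assms unfolding standard_borel_def polish_space_def by blast
  obtain M d where Md: "Metric_space M d" "S = Metric_space.mtopology M d"
    using S(1) unfolding completely_metrizable_space_def by blast
  interpret Metric_space M d by (rule Md(1))
  have top: "topspace S = M" using Md by simp
  have sets: "U \<in> sets Y" if "openin S U" for U
    using that S(2) openin_subset by (auto simp: borel_of_def sets_measure_of_conv intro: sigma_sets.Basic)
  have space: "space Y = M"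
    using sets_eq_imp_space_eq[OF S(2)] top by (simp add: borel_of_def space_measure_of_conv)
  define \<B> where "\<B> = (\<lambda>(a, n). mball a (1 / Suc n)) ` (D \<times> (UNIV :: nat set))"
  show thesis
  proof
    show "countable \<B>" using D by (auto simp: \<B>_def)
    show "\<B> \<subseteq> sets Y" using Md sets by (auto simp: \<B>_def)
    fix x y assume x: "x \<in> space Y" and y: "y \<in> space Y"
      and eq: "\<And>B. B \<in> \<B> \<Longrightarrow> x \<in> B \<longleftrightarrow> y \<in> B"
    show "x = y"
    proof (rule ccontr)
      assume "x \<noteq> y"
      then have "d x y > 0" using x y space by auto
      then obtain n where n: "1 / real (Suc n) < d x y / 2"
        by (metis half_gt_zero nat_approx_posE)
      have "x \<in> S closure_of D" using x space top D by simp
      then obtain a where a: "a \<in> D" "d x a < 1 / Suc n"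
        unfolding Md(2) metric_closure_of by (fastforce dest: spec[of _ "1 / real (Suc n)"])
      then have "mball a (1 / Suc n) \<in> \<B>" "x \<in> mball a (1 / Suc n)"
        using x space D top by (auto simp: \<B>_def commute)
      then have "y \<in> mball a (1 / Suc n)" using eq by blast
      then have "d x y < 2 * (1 / Suc n)"
        using triangle[of x a y] a x y space by auto
      with n show False by simp
    qed
  qed
qed

section \<open>The space of positive cones\<close>

text \<open>An elementwise form of the definition, in which every condition involves only finitely many values
  of the characteristic function of \<open>P\<close>; this makes closedness of the space of cones visible.\<close>

lemma (in group) positive_cone_iff:
  "positive_cone G P \<longleftrightarrow> P \<subseteq> carrier G \<and> (\<forall>g\<in>P. \<forall>h\<in>P. g \<otimes> h \<in> P) \<and> \<one> \<notin> P \<and>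
     (\<forall>g\<in>carrier G - {\<one>}. g \<in> P \<longleftrightarrow> inv g \<notin> P)"
proof (cases "P \<subseteq> carrier G")
  case True
  have inv: "x \<in> set_inv P \<longleftrightarrow> x \<in> carrier G \<and> inv x \<in> P" for x
  proof
    assume "x \<in> set_inv P"
    then show "x \<in> carrier G \<and> inv x \<in> P" using True by (auto simp: SET_INV_def subset_iff)
  next
    assume "x \<in> carrier G \<and> inv x \<in> P"
    then show "x \<in> set_inv P" unfolding SET_INV_def by (metis UN_iff inv_inv singletonI)
  qed
  have mult: "P <#> P \<subseteq> P \<longleftrightarrow> (\<forall>g\<in>P. \<forall>h\<in>P. g \<otimes> h \<in> P)"
    by (auto simp: set_mult_def)
  show ?thesis
  proof
    assume "positive_cone G P"
    then have "P \<inter> set_inv P = {}" "P \<union> set_inv P = carrier G - {\<one>}" "\<forall>g\<in>P. \<forall>h\<in>P. g \<otimes> h \<in> P"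
      by (auto simp: positive_cone_def mult)
    then show "P \<subseteq> carrier G \<and> (\<forall>g\<in>P. \<forall>h\<in>P. g \<otimes> h \<in> P) \<and> \<one> \<notin> P \<and>
        (\<forall>g\<in>carrier G - {\<one>}. g \<in> P \<longleftrightarrow> inv g \<notin> P)"
      using True inv by blast
  next
    assume *: "P \<subseteq> carrier G \<and> (\<forall>g\<in>P. \<forall>h\<in>P. g \<otimes> h \<in> P) \<and> \<one> \<notin> P \<and>
        (\<forall>g\<in>carrier G - {\<one>}. g \<in> P \<longleftrightarrow> inv g \<notin> P)"
    then have "\<one> \<notin> set_inv P" using inv by simp
    moreover from this have "P \<inter> set_inv P = {}" using * inv by blast
    moreover have "P \<union> set_inv P = carrier G - {\<one>}"
      using * inv \<open>\<one> \<notin> set_inv P\<close> by blast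
    ultimately show "positive_cone G P" using * by (simp add: positive_cone_def mult)
  qed
qed (simp add: positive_cone_def)

context group
begin

lemma positive_coneD:
  assumes "positive_cone G P"
  shows "P \<subseteq> carrier G" "\<And>g h. g \<in> P \<Longrightarrow> h \<in> P \<Longrightarrow> g \<otimes> h \<in> P" "\<one> \<notin> P"
    "\<And>g. g \<in> carrier G \<Longrightarrow> g \<noteq> \<one> \<Longrightarrow> g \<in> P \<longleftrightarrow> inv g \<notin> P"
  using assms unfolding positive_cone_iff by blast+

lemma inv_mult_cancel_left: "x \<in> carrier G \<Longrightarrow> y \<in> carrier G \<Longrightarrow> inv x \<otimes> (x \<otimes> y) = y"
  by (simp flip: m_assoc)

lemma mult_inv_cancel_left: "x \<in> carrier G \<Longrightarrow> y \<in> carrier G \<Longrightarrow> x \<otimes> (inv x \<otimes> y) = y"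
  by (simp flip: m_assoc)

lemma mem_conjugate_iff:
  assumes "g \<in> carrier G" "P \<subseteq> carrier G"
  shows "x \<in> conjugate G g P \<longleftrightarrow> x \<in> carrier G \<and> inv g \<otimes> x \<otimes> g \<in> P"
proof
  assume "x \<in> conjugate G g P"
  then obtain p where p: "p \<in> P" "x = g \<otimes> p \<otimes> inv g"
    by (auto simp: conjugate_def l_coset_def r_coset_def)
  then show "x \<in> carrier G \<and> inv g \<otimes> x \<otimes> g \<in> P"
    using assms by (auto simp: subset_iff m_assoc inv_mult_cancel_left)
next
  assume x: "x \<in> carrier G \<and> inv g \<otimes> x \<otimes> g \<in> P"
  then have "x = g \<otimes> (inv g \<otimes> x \<otimes> g) \<otimes> inv g"
    using assms by (simp add: m_assoc mult_inv_cancel_left)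
  then show "x \<in> conjugate G g P"
    using x unfolding conjugate_def l_coset_def r_coset_def by blast
qed

lemma conjugate_in_LO:
  assumes g: "g \<in> carrier G" and P: "P \<in> LO G"
  shows "conjugate G g P \<in> LO G"
proof -
  have P': "P \<subseteq> carrier G" "\<And>g h. g \<in> P \<Longrightarrow> h \<in> P \<Longrightarrow> g \<otimes> h \<in> P" "\<one> \<notin> P"
      "\<And>g. g \<in> carrier G \<Longrightarrow> g \<noteq> \<one> \<Longrightarrow> g \<in> P \<longleftrightarrow> inv g \<notin> P"
    using P positive_coneD[of P] by (auto simp only: LO_def mem_Collect_eq)
  have conj_one: "inv g \<otimes> x \<otimes> g = \<one> \<longleftrightarrow> x = \<one>" if "x \<in> carrier G" for x
  proof
    assume "inv g \<otimes> x \<otimes> g = \<one>"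
    then have "g \<otimes> (inv g \<otimes> x \<otimes> g) \<otimes> inv g = \<one>" using g by simp
    then show "x = \<one>" using that g by (simp add: m_assoc mult_inv_cancel_left)
  qed (use g in simp)
  have conj_inv: "inv g \<otimes> inv x \<otimes> g = inv (inv g \<otimes> x \<otimes> g)" if "x \<in> carrier G" for x
    using that g by (simp add: inv_mult_group m_assoc)
  have conj_mult: "inv g \<otimes> (x \<otimes> y) \<otimes> g = (inv g \<otimes> x \<otimes> g) \<otimes> (inv g \<otimes> y \<otimes> g)"
    if "x \<in> carrier G" "y \<in> carrier G" for x y
    using that g by (simp add: m_assoc mult_inv_cancel_left)
  note mem = mem_conjugate_iff[OF g P'(1)]
  show ?thesis
    unfolding LO_def positive_cone_iff mem_Collect_eq
  proof (intro conjI ballI)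
    show "conjugate G g P \<subseteq> carrier G" using mem by blast
    show "\<one> \<notin> conjugate G g P" using mem P'(3) g by simp
    show "x \<otimes> y \<in> conjugate G g P" if "x \<in> conjugate G g P" "y \<in> conjugate G g P" for x y
      using that P'(2) by (simp add: mem conj_mult)
    show "x \<in> conjugate G g P \<longleftrightarrow> inv x \<notin> conjugate G g P" if "x \<in> carrier G - {\<one>}" for x
      using that P'(4)[of "inv g \<otimes> x \<otimes> g"] g by (simp add: mem conj_inv conj_one)
  qed
qed

lemma conjugate_conjugate:
  assumes "g \<in> carrier G" "h \<in> carrier G" "P \<subseteq> carrier G"
  shows "conjugate G g (conjugate G h P) = conjugate G (g \<otimes> h) P"
proof -
  have "conjugate G h P \<subseteq> carrier G" using assms by (auto simp: mem_conjugate_iff)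
  then show ?thesis using assms
    by (auto simp: mem_conjugate_iff inv_mult_group m_assoc)
qed

lemma conjugate_one: "P \<subseteq> carrier G \<Longrightarrow> conjugate G \<one> P = P"
  by (auto simp: mem_conjugate_iff subset_iff)

end

lemma continuous_map_LO_membership:
  assumes "g \<in> carrier G"
  shows "continuous_map (LO_topology G) (discrete_topology UNIV) (\<lambda>P. g \<in> P)"
proof -
  have "continuous_map (LO_topology G) (discrete_topology (UNIV :: bool set))
      ((\<lambda>x. x g) \<circ> (\<lambda>P. \<lambda>g \<in> carrier G. g \<in> P))"
    unfolding LO_topology_def using assms
    by (intro continuous_map_pullback continuous_map_product_projection)
  then show ?thesis using assms by (simp add: o_def)
qed

lemma continuous_map_into_LO_topology:
  assumes "f \<in> topspace T \<rightarrow> LO G"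
    and "\<And>g. g \<in> carrier G \<Longrightarrow> continuous_map T (discrete_topology (UNIV :: bool set)) (\<lambda>x. g \<in> f x)"
  shows "continuous_map T (LO_topology G) f"
  unfolding LO_topology_def
proof (rule continuous_map_pullback')
  show "continuous_map T (product_topology (\<lambda>_. discrete_topology UNIV) (carrier G))
      ((\<lambda>P. \<lambda>g\<in>carrier G. g \<in> P) \<circ> f)"
    unfolding continuous_map_componentwise using assms(2)
    by (auto simp: o_def)
qed (use assms(1) in auto)

lemma (in group) continuous_map_conjugate:
  assumes "g \<in> carrier G"
  shows "continuous_map (LO_topology G) (LO_topology G) (conjugate G g)"
proof (rule continuous_map_into_LO_topology)
  show "conjugate G g \<in> topspace (LO_topology G) \<rightarrow> LO G"
    using assms by (auto simp: topspace_LO_topology conjugate_in_LO)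
  fix x assume x: "x \<in> carrier G"
  have "continuous_map (LO_topology G) (discrete_topology UNIV) (\<lambda>P. inv g \<otimes> x \<otimes> g \<in> P)"
    using assms x by (intro continuous_map_LO_membership) auto
  then show "continuous_map (LO_topology G) (discrete_topology UNIV) (\<lambda>P. x \<in> conjugate G g P)"
    by (rule continuous_map_eq)
       (use assms x in \<open>auto simp: topspace_LO_topology mem_conjugate_iff LO_def positive_cone_def\<close>)
qed

lemma LO_neighbourhood_finite:
  assumes "openin (LO_topology G) U" "P \<in> U"
  obtains I where "finite I" "I \<subseteq> carrier G"
    "\<And>Q. Q \<in> LO G \<Longrightarrow> (\<And>g. g \<in> I \<Longrightarrow> g \<in> Q \<longleftrightarrow> g \<in> P) \<Longrightarrow> Q \<in> U"
proof -
  let ?\<chi> = "\<lambda>P. \<lambda>g \<in> carrier G. g \<in> P"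
  obtain W where W: "openin (product_topology (\<lambda>_. discrete_topology (UNIV :: bool set)) (carrier G)) W"
      "U = ?\<chi> -` W \<inter> LO G"
    using assms(1) unfolding LO_topology_def openin_pullback_topology by blast
  then have "?\<chi> P \<in> W" using assms(2) by blast
  then obtain V where V: "finite {i \<in> carrier G. V i \<noteq> (UNIV :: bool set)}"
      "?\<chi> P \<in> Pi\<^sub>E (carrier G) V" "Pi\<^sub>E (carrier G) V \<subseteq> W"
    using W(1) unfolding openin_product_topology_alt topspace_discrete_topology by blast
  show thesis
  proof
    fix Q assume Q: "Q \<in> LO G"
      and eq: "\<And>g. g \<in> {i \<in> carrier G. V i \<noteq> UNIV} \<Longrightarrow> g \<in> Q \<longleftrightarrow> g \<in> P"
    have "?\<chi> Q g \<in> V g" if "g \<in> carrier G" for g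
    proof (cases "V g = UNIV")
      case False
      then have "?\<chi> Q g = ?\<chi> P g" using that eq by simp
      then show ?thesis using PiE_mem[OF V(2) that] by (rule ssubst)
    qed simp
    then have "?\<chi> Q \<in> Pi\<^sub>E (carrier G) V" by (simp add: PiE_iff)
    then show "Q \<in> U" using W V Q by blast
  qed (use V in auto)
qed

text \<open>The pullback topology is here the topology of an actual subspace of the product, so compactness and
  the Hausdorff property can be read off from the product of two-point spaces.\<close>

lemma homeomorphic_space_LO_topology:
  "LO_topology G homeomorphic_space
     subtopology (product_topology (\<lambda>_. discrete_topology (UNIV :: bool set)) (carrier G))
       ((\<lambda>P. \<lambda>g \<in> carrier G. g \<in> P) ` LO G)" (is "_ homeomorphic_space subtopology ?X (?\<chi> ` _)")
proof -
  have preimage: "{g \<in> carrier G. ?\<chi> P g} = P" if "P \<in> LO G" for P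
    using that by (auto simp: LO_def positive_cone_def)
  have top: "topspace (subtopology ?X (?\<chi> ` LO G)) = ?\<chi> ` LO G"
    by auto
  have "continuous_map (LO_topology G) (subtopology ?X (?\<chi> ` LO G)) ?\<chi>"
    unfolding continuous_map_in_subtopology continuous_map_componentwise
    by (auto simp: topspace_LO_topology continuous_map_LO_membership)
  moreover have "continuous_map (subtopology ?X (?\<chi> ` LO G)) (LO_topology G) (\<lambda>x. {g \<in> carrier G. x g})"
  proof (rule continuous_map_into_LO_topology)
    show "(\<lambda>x. {g \<in> carrier G. x g}) \<in> topspace (subtopology ?X (?\<chi> ` LO G)) \<rightarrow> LO G"
      unfolding top using preimage by auto
    fix g assume "g \<in> carrier G"
    then show "continuous_map (subtopology ?X (?\<chi> ` LO G)) (discrete_topology UNIV)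
        (\<lambda>x. g \<in> {g \<in> carrier G. x g})"
      using continuous_map_from_subtopology[OF continuous_map_product_projection] by fastforce
  qed
  ultimately have "homeomorphic_maps (LO_topology G) (subtopology ?X (?\<chi> ` LO G)) ?\<chi> (\<lambda>x. {g \<in> carrier G. x g})"
    unfolding homeomorphic_maps_def topspace_LO_topology top using preimage by auto
  then show ?thesis by (auto simp: homeomorphic_space_def)
qed

text \<open>The characteristic functions of cones are cut out of the product by conditions on at most three
  coordinates each, and every such condition is clopen.\<close>

lemma (in group) compact_Hausdorff_LO_topology:
  "compact_space (LO_topology G)" "Hausdorff_space (LO_topology G)"
proof -
  let ?X = "product_topology (\<lambda>_. discrete_topology (UNIV :: bool set)) (carrier G)"
  let ?\<chi> = "\<lambda>P. \<lambda>g \<in> carrier G. g \<in> P"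
  have X: "compact_space ?X" "Hausdorff_space ?X"
    by (auto simp: compact_space_product_topology compact_space_discrete_topology
        Hausdorff_space_product_topology)
  let ?S = "\<lambda>g. {x \<in> topspace ?X. x g}" and ?N = "\<lambda>g. {x \<in> topspace ?X. \<not> x g}"
  have clopen: "closedin ?X (?S g)" "closedin ?X (?N g)" if "g \<in> carrier G" for g
    using closedin_continuous_map_preimage[OF continuous_map_product_projection[OF that], of "\<lambda>_. discrete_topology UNIV" "{True}"]
      closedin_continuous_map_preimage[OF continuous_map_product_projection[OF that], of "\<lambda>_. discrete_topology UNIV" "{False}"]
    by simp_all
  have eq: "?\<chi> ` LO G = {x \<in> topspace ?X. (\<forall>g\<in>carrier G. \<forall>h\<in>carrier G. x g \<and> x h \<longrightarrow> x (g \<otimes> h))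
      \<and> \<not> x \<one> \<and> (\<forall>g\<in>carrier G - {\<one>}. x g \<longleftrightarrow> \<not> x (inv g))}" (is "_ = ?R")
  proof
    show "?\<chi> ` LO G \<subseteq> ?R"
    proof (rule image_subsetI)
      fix P assume "P \<in> LO G"
      then have P: "positive_cone G P" by (simp add: LO_def)
      have "?\<chi> P g \<longleftrightarrow> \<not> ?\<chi> P (inv g)" if "g \<in> carrier G - {\<one>}" for g
        using positive_coneD(4)[OF P, of g] that by simp
      then have "\<forall>g\<in>carrier G - {\<one>}. ?\<chi> P g \<longleftrightarrow> \<not> ?\<chi> P (inv g)" by blast
      moreover have "\<forall>g\<in>carrier G. \<forall>h\<in>carrier G. ?\<chi> P g \<and> ?\<chi> P h \<longrightarrow> ?\<chi> P (g \<otimes> h)"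
        using positive_coneD(2)[OF P] by simp
      moreover have "\<not> ?\<chi> P \<one>" "?\<chi> P \<in> topspace ?X" using positive_coneD(3)[OF P] by simp_all
      ultimately show "?\<chi> P \<in> ?R" by blast
    qed
    show "?R \<subseteq> ?\<chi> ` LO G"
    proof
      fix x assume x: "x \<in> ?R"
      then have "\<forall>g\<in>carrier G - {\<one>}. x g \<longleftrightarrow> \<not> x (inv g)" "\<not> x \<one>"
          "\<forall>g\<in>carrier G. \<forall>h\<in>carrier G. x g \<and> x h \<longrightarrow> x (g \<otimes> h)" by blast+
      then have "{g \<in> carrier G. x g} \<in> LO G"
        unfolding LO_def positive_cone_iff mem_Collect_eq
        using m_closed inv_closed by blast
      moreover have "x = ?\<chi> {g \<in> carrier G. x g}"
      proof -
        have "x \<in> topspace ?X" using x by blast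
        then have "x = restrict x (carrier G)" by (simp add: PiE_iff extensional_restrict)
        moreover have "restrict x (carrier G) = ?\<chi> {g \<in> carrier G. x g}" by (rule restrict_ext) simp
        ultimately show ?thesis by (rule trans)
      qed
      ultimately show "x \<in> ?\<chi> ` LO G" by blast
    qed
  qed
  \<comment> \<open>The first set in the union defining \<open>C\<^sub>2\<close> is everything for \<open>g = \<one>\<close>, and empty otherwise: it
    lets the intersection range over all of \<open>G\<close>, so that it is never an empty intersection.\<close>
  define C\<^sub>1 where "C\<^sub>1 = (\<Inter>g\<in>carrier G. \<Inter>h\<in>carrier G. ?N g \<union> ?N h \<union> ?S (g \<otimes> h))"
  define C\<^sub>2 where "C\<^sub>2 = (\<Inter>g\<in>carrier G.
      {x \<in> topspace ?X. g = \<one>} \<union> (?S g \<inter> ?N (inv g)) \<union> (?N g \<inter> ?S (inv g)))"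
  have ne: "carrier G \<noteq> {}" using one_closed by blast
  have "closedin ?X C\<^sub>1"
    unfolding C\<^sub>1_def by (intro closedin_INT ne closedin_Un clopen m_closed)
  moreover have "closedin ?X {x \<in> topspace ?X. g = \<one>}" for g
    using closedin_topspace[of ?X] by (cases "g = \<one>") simp_all
  then have "closedin ?X C\<^sub>2"
    unfolding C\<^sub>2_def by (intro closedin_INT ne closedin_Un closedin_Int clopen inv_closed)
  moreover have R: "?R = ?N \<one> \<inter> C\<^sub>1 \<inter> C\<^sub>2"
  proof (rule Set.set_eqI)
    fix x
    show "x \<in> ?R \<longleftrightarrow> x \<in> ?N \<one> \<inter> C\<^sub>1 \<inter> C\<^sub>2"
      unfolding C\<^sub>1_def C\<^sub>2_def Int_iff INT_iff Un_iff mem_Collect_eq by blast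
  qed
  ultimately have "closedin ?X (?\<chi> ` LO G)"
    unfolding eq R by (intro closedin_Int clopen one_closed)
  then have "compact_space (subtopology ?X (?\<chi> ` LO G))"
    using X closedin_compact_space compact_space_subtopology by blast
  then show "compact_space (LO_topology G)"
    using homeomorphic_compact_space homeomorphic_space_LO_topology by blast
  show "Hausdorff_space (LO_topology G)"
    using X Hausdorff_space_subtopology homeomorphic_Hausdorff_space homeomorphic_space_LO_topology by blast
qed

section \<open>Free points accumulate on themselves\<close>

lemma (in group) positive_cone_least:
  assumes P: "positive_cone G P" and "finite S" "S \<noteq> {}" "S \<subseteq> P"
  shows "\<exists>h\<in>S. \<forall>g\<in>S. g = h \<or> inv h \<otimes> g \<in> P"
  using assms(2-4)
proof (induction S rule: finite_ne_induct)
  case (insert x S)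
  have P': "P \<subseteq> carrier G" "\<And>g h. g \<in> P \<Longrightarrow> h \<in> P \<Longrightarrow> g \<otimes> h \<in> P" "\<one> \<notin> P"
      "\<And>g. g \<in> carrier G \<Longrightarrow> g \<noteq> \<one> \<Longrightarrow> g \<in> P \<longleftrightarrow> inv g \<notin> P"
    using positive_coneD[OF P] by blast+
  obtain h where h: "h \<in> S" "\<forall>g\<in>S. g = h \<or> inv h \<otimes> g \<in> P" using insert by auto
  have c: "x \<in> carrier G" "h \<in> carrier G" "S \<subseteq> carrier G" using insert h P' by auto
  have "x \<noteq> h" using h insert by auto
  then have ne: "inv h \<otimes> x \<noteq> \<one>" using c by (metis inv_closed inv_equality inv_inv)
  show ?case
  proof (cases "inv h \<otimes> x \<in> P")
    case True
    then show ?thesis using h by auto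
  next
    case False
    then have x: "inv x \<otimes> h \<in> P" using P'(4)[of "inv h \<otimes> x"] c ne by (auto simp: inv_mult_group)
    have "inv x \<otimes> g \<in> P" if g: "g \<in> S" for g
    proof (cases "g = h")
      case True
      then show ?thesis using x by simp
    next
      case False
      then have "inv x \<otimes> h \<otimes> (inv h \<otimes> g) \<in> P" using x h g P' by blast
      moreover have "inv x \<otimes> h \<otimes> (inv h \<otimes> g) = inv x \<otimes> g"
        using c g by (simp add: m_assoc mult_inv_cancel_left subset_iff)
      ultimately show ?thesis by simp
    qed
    then show ?thesis by blast
  qed
qed auto

text \<open>The least \<open>h\<close> of the given elements works: \<open>h\<^sup>-\<^sup>1 g\<close> is positive or trivial, and multiplying it by the
  positive element \<open>h\<close> gives a positive element.\<close>

lemma (in group) positive_cone_finitely_many_conjugates: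
  assumes P: "positive_cone G P" and nontriv: "carrier G \<noteq> {\<one>}" and "finite S" "S \<subseteq> P"
  shows "\<exists>h\<in>carrier G - {\<one>}. \<forall>g\<in>S. inv h \<otimes> g \<otimes> h \<in> P"
proof (cases "S = {}")
  case True
  then show ?thesis using nontriv one_closed by auto
next
  case False
  have P': "P \<subseteq> carrier G" "\<And>g h. g \<in> P \<Longrightarrow> h \<in> P \<Longrightarrow> g \<otimes> h \<in> P" "\<one> \<notin> P"
    using positive_coneD[OF P] by blast+
  obtain h where h: "h \<in> S" "\<forall>g\<in>S. g = h \<or> inv h \<otimes> g \<in> P"
    using positive_cone_least[OF P assms(3) False assms(4)] by blast
  have "h \<in> P" "h \<in> carrier G" "h \<noteq> \<one>" using h assms(4) P' by auto
  moreover have "inv h \<otimes> g \<otimes> h \<in> P" if "g \<in> S" for g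
    using h that P' \<open>h \<in> P\<close> \<open>h \<in> carrier G\<close> by (cases "g = h") auto
  ultimately show ?thesis by blast
qed

text \<open>Exactly one of \<open>g\<close> and its inverse is positive when \<open>g\<close> is nontrivial. So agreeing with \<open>P\<close> on
  finitely many elements amounts to keeping finitely many elements of \<open>P\<close> positive, which a
  nontrivial conjugation can do; freeness makes the conjugate a different cone.\<close>

lemma (in group) free_cone_accumulates_on_itself:
  assumes P: "P \<in> LO_free G" and nontriv: "carrier G \<noteq> {\<one>}"
    and U: "openin (LO_topology G) U" "P \<in> U"
  shows "\<exists>g\<in>carrier G. conjugate G g P \<in> U \<and> conjugate G g P \<noteq> P"
proof -
  have PLO: "P \<in> LO G" and free: "\<And>g. g \<in> carrier G \<Longrightarrow> g \<noteq> \<one> \<Longrightarrow> inv g <# P #> g \<noteq> P"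
    using P by (auto simp: LO_free_def)
  then have pc: "positive_cone G P" by (simp add: LO_def)
  then have P': "P \<subseteq> carrier G" "\<one> \<notin> P"
      "\<And>g. g \<in> carrier G \<Longrightarrow> g \<noteq> \<one> \<Longrightarrow> g \<in> P \<longleftrightarrow> inv g \<notin> P"
    using positive_coneD[OF pc] by blast+
  obtain I where I: "finite I" "I \<subseteq> carrier G"
    "\<And>Q. Q \<in> LO G \<Longrightarrow> (\<And>g. g \<in> I \<Longrightarrow> g \<in> Q \<longleftrightarrow> g \<in> P) \<Longrightarrow> Q \<in> U"
    using LO_neighbourhood_finite[OF U] by metis
  define S where "S = (I \<union> m_inv G ` I) \<inter> P"
  obtain h where h: "h \<in> carrier G" "h \<noteq> \<one>" "\<And>g. g \<in> S \<Longrightarrow> inv h \<otimes> g \<otimes> h \<in> P"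
    using positive_cone_finitely_many_conjugates[OF pc nontriv, of S] I(1) by (auto simp: S_def)
  define Q where "Q = conjugate G h P"
  have Q: "Q \<in> LO G" unfolding Q_def using h PLO conjugate_in_LO by blast
  then have Q': "\<one> \<notin> Q" "\<And>g. g \<in> carrier G \<Longrightarrow> g \<noteq> \<one> \<Longrightarrow> g \<in> Q \<longleftrightarrow> inv g \<notin> Q"
    using positive_coneD[of Q] unfolding LO_def by blast+
  have SQ: "g \<in> Q" if "g \<in> S" for g
    using that h P' by (auto simp: Q_def mem_conjugate_iff S_def)
  have "g \<in> Q \<longleftrightarrow> g \<in> P" if "g \<in> I" for g
  proof (cases "g = \<one>")
    case False
    then show ?thesis
      using that I(2) SQ[of g] SQ[of "inv g"] P'(3)[of g] Q'(2)[of g] by (auto simp: S_def)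
  qed (use P' Q' in auto)
  then have "Q \<in> U" using I(3) Q by blast
  moreover have "Q \<noteq> P"
    using free[of "inv h"] h by (auto simp: Q_def conjugate_def inv_eq_1_iff)
  ultimately show ?thesis using h by (auto simp: Q_def)
qed

section \<open>Nonsmoothness\<close>

theorem proposition3p9:
  fixes G :: "('a, 'b) monoid_scheme"
  assumes "group G"
    and "countable (carrier G)"
    and "left_orderable G"
    and "carrier G \<noteq> {\<one>\<^bsub>G\<^esub>}"
    and "LO_free G \<noteq> {}"
  shows "\<not> smooth TYPE('y) (LO_topology G) (E_lo G)"
proof
  interpret group G by (rule assms(1))
  let ?L = "LO_topology G"
  assume "smooth TYPE('y) ?L (E_lo G)"
  then obtain Y :: "'y measure" and \<theta> where Y: "standard_borel Y" and \<theta>: "\<theta> \<in> borel_of ?L \<rightarrow>\<^sub>M Y"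
    and iff: "\<And>P Q. P \<in> LO G \<Longrightarrow> Q \<in> LO G \<Longrightarrow> (P, Q) \<in> E_lo G \<longleftrightarrow> \<theta> P = \<theta> Q"
    unfolding smooth_def topspace_LO_topology by blast
  have \<theta>_orbit: "\<theta> P = \<theta> Q \<longleftrightarrow> (\<exists>g\<in>carrier G. Q = conjugate G g P)" if "P \<in> LO G" "Q \<in> LO G" for P Q
    using iff[OF that, symmetric] that by (auto simp: E_lo_def orbit_def)
  have \<theta>_inv: "\<theta> (conjugate G g P) = \<theta> P" if "P \<in> LO G" "g \<in> carrier G" for P g
    using \<theta>_orbit[of P "conjugate G g P"] conjugate_in_LO that by metis
  have sub: "Q \<subseteq> carrier G" if "Q \<in> LO G" for Q
    using that by (simp add: LO_def positive_cone_def)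
  obtain P where P: "P \<in> LO_free G" using assms(5) by blast
  then have PLO: "P \<in> LO G" by (simp add: LO_free_def)
  define orb where "orb = (\<lambda>g. conjugate G g P) ` carrier G"
  have orb: "orb \<subseteq> LO G" unfolding orb_def using PLO conjugate_in_LO by blast
  have orb_inv: "conjugate G g Q \<in> orb" if "Q \<in> orb" "g \<in> carrier G" for g Q
    using that PLO sub by (auto simp: orb_def conjugate_conjugate)
  define K where "K = ?L closure_of orb"
  define T where "T = subtopology ?L K"
  have KLO: "K \<subseteq> LO G" unfolding K_def using closure_of_subset_topspace[of ?L orb] by (simp add: topspace_LO_topology)
  have topT: "topspace T = K" using KLO by (auto simp: T_def topspace_LO_topology)
  have orbK: "orb \<subseteq> K" unfolding K_def using orb by (simp add: closure_of_subset topspace_LO_topology)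
  have "conjugate G \<one>\<^bsub>G\<^esub> P \<in> orb" unfolding orb_def using one_closed by blast
  then have PK: "P \<in> K" using orbK conjugate_one[OF sub[OF PLO]] by auto

  have dense: "\<exists>g\<in>carrier G. conjugate G g P \<in> U" if "openin T U" "U \<noteq> {}" for U
  proof -
    obtain W where W: "openin ?L W" "U = W \<inter> K" using \<open>openin T U\<close> unfolding T_def openin_subtopology by blast
    then obtain x where "x \<in> W" "x \<in> ?L closure_of orb" using \<open>U \<noteq> {}\<close> unfolding K_def by blast
    then obtain y where "y \<in> orb" "y \<in> W" using W(1) unfolding in_closure_of by blast
    then show ?thesis using orbK W by (auto simp: orb_def)
  qed
  have conjK: "conjugate G g ` K \<subseteq> K" if g: "g \<in> carrier G" for g
  proof -
    have "conjugate G g ` (?L closure_of orb) \<subseteq> ?L closure_of (conjugate G g ` orb)"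
      by (rule continuous_map_image_closure_subset[OF continuous_map_conjugate[OF g]])
    also have "\<dots> \<subseteq> ?L closure_of orb"
      using orb_inv g by (intro closure_of_mono) auto
    finally show ?thesis by (simp add: K_def)
  qed
  have contT: "continuous_map T T (conjugate G g)" if "g \<in> carrier G" for g
    unfolding T_def continuous_map_in_subtopology
    using that conjK[OF that] KLO continuous_map_conjugate
    by (auto simp: topspace_LO_topology intro: continuous_map_from_subtopology)
  have hom: "homeomorphic_map T T (conjugate G g)" if g: "g \<in> carrier G" for g
    unfolding homeomorphic_map_maps
  proof (intro exI)
    show "homeomorphic_maps T T (conjugate G g) (conjugate G (inv\<^bsub>G\<^esub> g))"
      unfolding homeomorphic_maps_def using contT g KLO sub
      by (auto simp: topT conjugate_conjugate conjugate_one subset_iff)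
  qed

  have T: "locally_compact_space T" "Hausdorff_space T" "topspace T \<noteq> {}"
  proof -
    have "compactin ?L K"
      unfolding K_def by (rule closedin_compact_space[OF compact_Hausdorff_LO_topology(1) closedin_closure_of])
    then show "locally_compact_space T"
      unfolding T_def by (intro compact_imp_locally_compact_space compact_space_subtopology)
    show "Hausdorff_space T"
      unfolding T_def by (intro Hausdorff_space_subtopology compact_Hausdorff_LO_topology(2))
    show "topspace T \<noteq> {}" using PK topT by blast
  qed
  \<comment> \<open>An isolated point of \<open>K\<close> is some \<open>h P h\<^sup>-\<^sup>1\<close>; pulled back by \<open>h\<close>, an isolating neighbourhood
    still contains another conjugate of \<open>P\<close>.\<close>
  have perfect: "\<not> openin T {x}" if "x \<in> topspace T" for x
  proof
    assume op: "openin T {x}"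
    then obtain h where h: "h \<in> carrier G" "x = conjugate G h P" using dense by blast
    obtain W where W: "openin ?L W" "{x} = W \<inter> K" using op unfolding T_def openin_subtopology by blast
    have "openin ?L {Q \<in> topspace ?L. conjugate G h Q \<in> W}"
      using continuous_map_conjugate[OF h(1)] W(1) openin_continuous_map_preimage by blast
    moreover have "P \<in> {Q \<in> topspace ?L. conjugate G h Q \<in> W}"
      using W h PLO by (auto simp: topspace_LO_topology)
    ultimately obtain g where g: "g \<in> carrier G" "conjugate G h (conjugate G g P) \<in> W" "conjugate G g P \<noteq> P"
      using free_cone_accumulates_on_itself[OF P assms(4)] by blast
    have "conjugate G g P \<in> orb" using g by (auto simp: orb_def)
    then have "conjugate G h (conjugate G g P) \<in> W \<inter> K" using g orb_inv h orbK by blast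
    then have "conjugate G h (conjugate G g P) = conjugate G h P" using W h by auto
    then have "conjugate G (inv\<^bsub>G\<^esub> h) (conjugate G h (conjugate G g P)) = conjugate G (inv\<^bsub>G\<^esub> h) (conjugate G h P)"
      by simp
    then show False
      using g h sub PLO conjugate_in_LO by (simp add: conjugate_conjugate conjugate_one flip: m_assoc)
  qed
  have trans: "\<exists>f\<in>conjugate G ` carrier G. f ` U \<inter> W \<noteq> {}"
    if U: "openin T U" and W: "openin T W" and ne: "U \<noteq> {}" "W \<noteq> {}" for U W
  proof -
    obtain a b where a: "a \<in> carrier G" "conjugate G a P \<in> U" and b: "b \<in> carrier G" "conjugate G b P \<in> W"
      using dense[OF U ne(1)] dense[OF W ne(2)] by blast
    have "conjugate G (b \<otimes>\<^bsub>G\<^esub> inv\<^bsub>G\<^esub> a) (conjugate G a P) = conjugate G b P"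
      using a b sub PLO by (simp add: conjugate_conjugate m_assoc)
    then show ?thesis using a b by (intro bexI[of _ "conjugate G (b \<otimes>\<^bsub>G\<^esub> inv\<^bsub>G\<^esub> a)"]) (auto intro!: image_eqI)
  qed

  obtain \<B> where \<B>: "countable \<B>" "\<B> \<subseteq> sets Y"
    "\<And>x y. x \<in> space Y \<Longrightarrow> y \<in> space Y \<Longrightarrow> (\<And>B. B \<in> \<B> \<Longrightarrow> x \<in> B \<longleftrightarrow> y \<in> B) \<Longrightarrow> x = y"
    using standard_borel_countably_separated[OF Y] by metis
  have spaceL: "space (borel_of ?L) = LO G" and spaceT: "space (borel_of T) = K"
    by (simp_all add: borel_of_def space_measure_of_conv topspace_LO_topology topT)
  have "(\<lambda>x. x) \<in> borel_of T \<rightarrow>\<^sub>M borel_of ?L"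
    unfolding borel_of_def[of ?L]
  proof (rule measurable_measure_of)
    fix U assume "U \<in> {U. openin ?L U}"
    then have "openin T ((\<lambda>x. x) -` U \<inter> space (borel_of T))"
      unfolding spaceT unfolding T_def openin_subtopology by auto
    then show "(\<lambda>x. x) -` U \<inter> space (borel_of T) \<in> sets (borel_of T)"
      using openin_subset by (auto simp: borel_of_def sets_measure_of_conv intro: sigma_sets.Basic)
  next
    show "{U. openin ?L U} \<subseteq> Pow (topspace ?L)" using openin_subset by auto
    show "(\<lambda>x. x) \<in> space (borel_of T) \<rightarrow> topspace ?L"
      using KLO spaceT by (auto simp: topspace_LO_topology)
  qed
  from measurable_compose[OF this \<theta>] have \<theta>T: "\<theta> \<in> borel_of T \<rightarrow>\<^sub>M Y" .
  define \<A> where "\<A> = (\<lambda>B. \<theta> -` B \<inter> K) ` \<B>"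
  have "\<exists>x\<in>topspace T. uncountable {y \<in> topspace T. \<forall>A\<in>\<A>. y \<in> A \<longleftrightarrow> x \<in> A}"
  proof (rule uncountable_class_of_invariant_borel_family[where F = "conjugate G ` carrier G"])
    show "countable (conjugate G ` carrier G)" using assms(2) by simp
    show "countable \<A>" using \<B> by (simp add: \<A>_def)
    show "\<A> \<subseteq> sets (borel_of T)"
      using measurable_sets[OF \<theta>T] \<B> spaceT by (auto simp: \<A>_def)
    show "f x \<in> A \<longleftrightarrow> x \<in> A"
      if A: "A \<in> \<A>" and f: "f \<in> conjugate G ` carrier G" and x: "x \<in> topspace T" for A f x
    proof -
      obtain B g where "A = \<theta> -` B \<inter> K" and g: "g \<in> carrier G" "f = conjugate G g"
        using A f by (auto simp: \<A>_def)
      moreover have "x \<in> K" "f x \<in> K" using x g conjK[of g] by (auto simp: topT)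
      moreover have "\<theta> (f x) = \<theta> x" using \<theta>_inv[of x g] \<open>x \<in> K\<close> KLO g by auto
      ultimately show ?thesis by simp
    qed
  qed (use T perfect trans hom in auto)
  then obtain x where x: "x \<in> K" and unc: "uncountable {y \<in> K. \<forall>A\<in>\<A>. y \<in> A \<longleftrightarrow> x \<in> A}"
    unfolding topT by blast
  have "{y \<in> K. \<forall>A\<in>\<A>. y \<in> A \<longleftrightarrow> x \<in> A} \<subseteq> (\<lambda>g. conjugate G g x) ` carrier G"
  proof
    fix y assume y: "y \<in> {y \<in> K. \<forall>A\<in>\<A>. y \<in> A \<longleftrightarrow> x \<in> A}"
    have xy: "x \<in> LO G" "y \<in> LO G" using x y KLO by auto
    have "\<theta> x = \<theta> y"
      using y x measurable_space[OF \<theta>T] spaceT by (intro \<B>(3)) (fastforce simp: \<A>_def)+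
    then show "y \<in> (\<lambda>g. conjugate G g x) ` carrier G"
      using \<theta>_orbit[of x y] xy by (simp add: image_iff)
  qed
  from countable_subset[OF this countable_image[OF assms(2)]] show False using unc by contradiction
qed

end
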